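(* Let $k\ge 3$, let $H$ be a finite $k$-NU graph, and let $u,v$ be vertices of $H$ at distance $d=d_H(u,v)$. Then the shortest path reconfiguration graph $\mathrm{SP}(H,u,v)$ has diameter at most $(k-2)\binom{d+1}{2}$.
   Context: Graphs are undirected, may have loops, and have no multiple edges. A homomorphism is an edge-preserving vertex map. $H^k$ is the $k$-fold categorical product: tuples are adjacent iff they are adjacent in every coordinate. For $k\ge 3$, $H$ is a $k$-NU graph if there is a homomorphism $f:H^k\to H$ such that $f(x_1,\dots,x_k)=x$ whenever at least $k-1$ of the $x_i$ are equal to $x$. $\mathrm{SP}(H,u,v)$ is the graph whose vertices are the shortest $uv$-paths in $H$, two being adjacent if they differ in exactly one vertex. *)

theory Defs
  imports
    "Graph_Theory.Graph_Theory"
    "HOL-Library.FuncSet"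
begin

text \<open>
  A finite undirected graph, loops allowed and without multiple edges, is a digraph satisfying
  \<^locale>\<open>pair_pseudo_graph\<close>: its edges form a symmetric set of ordered pairs of vertices.
\<close>

definition graph_hom :: "'a pair_pre_digraph \<Rightarrow> 'b pair_pre_digraph \<Rightarrow> ('a \<Rightarrow> 'b) \<Rightarrow> bool" where
  "graph_hom G H f \<longleftrightarrow>
     f \<in> pverts G \<rightarrow> pverts H \<and> (\<forall>(x, y) \<in> parcs G. (f x, f y) \<in> parcs H)"

text \<open>A tuple \<open>(x\<^sub>1, \<dots>, x\<^sub>k)\<close> is an extensional function on \<open>{1..k}\<close>.\<close>

definition graph_power :: "'a pair_pre_digraph \<Rightarrow> nat \<Rightarrow> (nat \<Rightarrow> 'a) pair_pre_digraph" where
  "graph_power H k =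
     \<lparr> pverts = {1..k} \<rightarrow>\<^sub>E pverts H,
       parcs = {(x, y). x \<in> {1..k} \<rightarrow>\<^sub>E pverts H \<and> y \<in> {1..k} \<rightarrow>\<^sub>E pverts H \<and>
                        (\<forall>i \<in> {1..k}. (x i, y i) \<in> parcs H)} \<rparr>"

definition nu_graph :: "nat \<Rightarrow> 'a pair_pre_digraph \<Rightarrow> bool" where
  "nu_graph k H \<longleftrightarrow>
     (\<exists>f. graph_hom (graph_power H k) H f \<and>
          (\<forall>x \<in> pverts (graph_power H k). \<forall>a \<in> pverts H.
             card {i \<in> {1..k}. x i = a} \<ge> k - 1 \<longrightarrow> f x = a))"

text \<open>
  Distance is the infimum of the lengths of walks, taken in the extended reals: it is \<open>\<infinity>\<close> between
  vertices in different components. In particular a nonempty disconnected graph has infinite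
  diameter.
\<close>

definition graph_dist :: "'a pair_pre_digraph \<Rightarrow> 'a \<Rightarrow> 'a \<Rightarrow> ereal" where
  "graph_dist G u v = wf_digraph.\<mu> (with_proj G) (\<lambda>_. 1) u v"

definition graph_diameter :: "'a pair_pre_digraph \<Rightarrow> ereal" where
  "graph_diameter G = (SUP u \<in> pverts G. SUP v \<in> pverts G. graph_dist G u v)"

definition shortest_path :: "'a pair_pre_digraph \<Rightarrow> 'a \<Rightarrow> 'a \<Rightarrow> 'a vwalk \<Rightarrow> bool" where
  "shortest_path H u v p \<longleftrightarrow>
     vpath p (with_proj H) \<and> hd p = u \<and> last p = v \<and>
     ereal (real (vwalk_length p)) = graph_dist H u v"

text \<open>
  All shortest paths from \<open>u\<close> to \<open>v\<close> have the same length, and a vertex occurring on two of them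
  occurs at the same position (its distance from \<open>u\<close>). Differing in exactly one vertex therefore
  means differing at exactly one position.
\<close>

definition sp_graph :: "'a pair_pre_digraph \<Rightarrow> 'a \<Rightarrow> 'a \<Rightarrow> 'a vwalk pair_pre_digraph" where
  "sp_graph H u v =
     \<lparr> pverts = {p. shortest_path H u v p},
       parcs = {(p, q). shortest_path H u v p \<and> shortest_path H u v q \<and>
                        (\<exists>!i. i < length p \<and> p ! i \<noteq> q ! i)} \<rparr>"

lemma shortest_path_length_eq:
  assumes "shortest_path H u v p" "shortest_path H u v q"
  shows "length p = length q"
proof -
  have "p \<noteq> []" "q \<noteq> []"
    using assms by (auto simp: shortest_path_def vpath_def vwalk_def)
  moreover have "ereal (real (vwalk_length p)) = ereal (real (vwalk_length q))"
    using assms by (simp only: shortest_path_def)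
  then have "length p - 1 = length q - 1" by simp
  ultimately show ?thesis by (cases p; cases q) auto
qed

lemma pair_bidirected_digraph_sp_graph: "pair_bidirected_digraph (sp_graph H u v)"
proof unfold_locales
  show "symmetric (with_proj (sp_graph H u v))"
    unfolding symmetric_def with_proj_simps
  proof (rule symI)
    fix p q assume "(p, q) \<in> parcs (sp_graph H u v)"
    then have sp: "shortest_path H u v p" "shortest_path H u v q"
      and diff: "\<exists>!i. i < length p \<and> p ! i \<noteq> q ! i"
      by (simp_all add: sp_graph_def)
    from diff have "\<exists>!i. i < length q \<and> q ! i \<noteq> p ! i"
      unfolding shortest_path_length_eq[OF sp] by (simp only: eq_commute)
    with sp show "(q, p) \<in> parcs (sp_graph H u v)"
      by (simp add: sp_graph_def)
  qed
qed (auto simp: sp_graph_def)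

lemma pair_pseudo_graph_graph_power:
  assumes "pair_pseudo_graph H"
  shows "pair_pseudo_graph (graph_power H k)"
proof -
  interpret pair_pseudo_graph H by fact
  have fin: "finite ({1..k} \<rightarrow>\<^sub>E pverts H)"
    by (intro finite_PiE) (simp_all add: pair_finite_verts)
  show ?thesis
  proof unfold_locales
    show "finite (pverts (graph_power H k))"
      using fin by (simp add: graph_power_def)
    show "finite (parcs (graph_power H k))"
      by (rule finite_subset[OF _ finite_cartesian_product[OF fin fin]])
        (auto simp: graph_power_def)
    show "symmetric (with_proj (graph_power H k))"
      unfolding symmetric_def with_proj_simps
      by (rule symI) (auto simp: graph_power_def intro: arcs_symmetric)
  qed (auto simp: graph_power_def)
qed

end

(*
  Apply the near-unanimity map f coordinatewise to the tuple of walks (Q, ..., Q, W, P, ..., P) of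
  length d, where P and Q are shortest uv-paths and W is any walk of length d starting at u.  The
  result is a shortest uv-path, because at the last position at most one of the k entries differs
  from v.  So W may be deformed from P to Q with its last vertex free: it slides along the walk
  formed by the reverse of Q followed by P, from one end to the other.  Position i of W moves by 2i
  in steps of 2, so a deformation takes 1 + ... + d single-vertex changes.  It is performed in the
  coordinates 2, ..., k - 1 only, as f (Q, P, ..., P) = P and f (Q, ..., Q, P) = Q.
*)
theory Submission
  imports Defs
begin

section \<open>Iterated relations and bounds on the distance\<close>

lemma relpowp_sum:
  assumes "\<And>i. i < n \<Longrightarrow> (R ^^ c i) (w i) (w (Suc i))"
  shows "(R ^^ (\<Sum>i<n. c i)) (w 0) (w (n::nat))"
  using assms
proof (induction n)
  case (Suc n)
  then have "(R ^^ (\<Sum>i<n. c i)) (w 0) (w n)" "(R ^^ c n) (w n) (w (Suc n))" by simp_all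
  then show ?case by (auto simp: relpowp_add)
qed simp

lemma relpowp_image:
  assumes "(R ^^ n) x y" and "\<And>a b. R a b \<Longrightarrow> S (g a) (g b)"
  shows "(S ^^ n) (g x) (g y)"
  using assms(1)
proof (induction n arbitrary: y)
  case (Suc n)
  then show ?case by (auto intro: assms(2))
qed simp

lemma graph_dist_le_of_awalk:
  assumes "pair_wf_digraph G" and "pre_digraph.awalk (with_proj G) x es y"
  shows "graph_dist G x y \<le> ereal (real (length es))"
proof -
  interpret pair_wf_digraph G by fact
  have "awalk_cost (\<lambda>_. 1) es = real (length es)" by (induction es) simp_all
  then show ?thesis
    using min_cost_le_walk_cost[OF assms(2), of "\<lambda>_. 1"] by (simp add: graph_dist_def)
qed

text \<open>Equality is allowed in each step because a change in one walk of the tuple may be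
  absorbed by the near-unanimity map. Idle steps add no arc, so the walk obtained has at most
  \<open>n\<close> arcs.\<close>

lemma graph_dist_le_of_relpowp:
  assumes wf: "pair_wf_digraph G" and x: "x \<in> pverts G"
    and "((\<lambda>a b. a = b \<or> (a, b) \<in> parcs G) ^^ n) x y"
  shows "graph_dist G x y \<le> ereal (real n)"
proof -
  interpret pair_wf_digraph G by fact
  have "\<exists>es. awalk x es y \<and> length es \<le> n"
    using assms(3)
  proof (induction n arbitrary: y)
    case 0
    then show ?case using x by (auto intro!: exI[of _ "[]"] simp: awalk_Nil_iff)
  next
    case (Suc n)
    then obtain z es where z: "z = y \<or> (z, y) \<in> parcs G" and es: "awalk x es z" "length es \<le> n"
      by (elim relpowp_Suc_E) blast
    show ?case
    proof (cases "z = y")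
      case False
      with z have "awalk z [(z, y)] y" using arc_implies_awalk[of "(z, y)"] by auto
      then have "awalk x (es @ [(z, y)]) y" using es by auto
      with es show ?thesis by (intro exI[of _ "es @ [(z, y)]"]) auto
    qed (use es in auto)
  qed
  then obtain es where "awalk x es y" "length es \<le> n" by blast
  with graph_dist_le_of_awalk[OF wf, of x es y] show ?thesis
    by (meson ereal_less_eq(3) of_nat_mono order_trans)
qed

lemma graph_dist_le_vwalk_length:
  assumes wf: "pair_wf_digraph G" and "vwalk p (with_proj G)"
  shows "graph_dist G (hd p) (last p) \<le> ereal (real (vwalk_length p))"
proof -
  interpret pair_wf_digraph G by fact
  have "awalk (hd p) (vwalk_arcs p) (last p)"
    using assms(2) by (induction p) (auto simp: awalk_Nil_iff awalk_Cons_iff)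
  from graph_dist_le_of_awalk[OF wf this] show ?thesis by (simp only: vwalk_length_def)
qed

section \<open>Walks and shortest paths\<close>

text \<open>The walks constructed below arise as \<open>map\<close> over positions, so they are best
  checked position by position.\<close>

lemma vwalk_iff_nth:
  assumes "pair_wf_digraph G"
  shows "vwalk p (with_proj G) \<longleftrightarrow> p \<noteq> [] \<and> set p \<subseteq> pverts G \<and>
    (\<forall>i. Suc i < length p \<longrightarrow> (p ! i, p ! Suc i) \<in> parcs G)"
proof -
  interpret pair_wf_digraph G by fact
  show ?thesis
  proof (induction p rule: vwalk_arcs.induct)
    case (3 x y xs)
    have "(\<forall>i. Suc i < length (x # y # xs) \<longrightarrow> ((x # y # xs) ! i, (x # y # xs) ! Suc i) \<in> parcs G)
      \<longleftrightarrow> (x, y) \<in> parcs G \<and>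
        (\<forall>i. Suc i < length (y # xs) \<longrightarrow> ((y # xs) ! i, (y # xs) ! Suc i) \<in> parcs G)"
      (is "?L \<longleftrightarrow> ?R")
    proof
      assume ?L
      then show ?R by (metis Suc_less_eq length_Cons nth_Cons_0 nth_Cons_Suc zero_less_Suc)
    next
      assume R: ?R
      show ?L
      proof (intro allI impI)
        fix i assume "Suc i < length (x # y # xs)"
        with R show "((x # y # xs) ! i, (x # y # xs) ! Suc i) \<in> parcs G" by (cases i) auto
      qed
    qed
    with 3 show ?case by (auto dest: wellformed')
  qed (auto simp: vwalk_def)
qed

text \<open>Distinctness comes for free: cutting out the closed piece between two occurrences of a
  vertex would leave a walk from \<open>u\<close> to \<open>v\<close> shorter than the
  distance.\<close>

lemma shortest_pathI:
  assumes wf: "pair_wf_digraph H" and p: "vwalk p (with_proj H)" "hd p = u" "last p = v"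
    and len: "ereal (real (vwalk_length p)) = graph_dist H u v"
  shows "shortest_path H u v p"
proof -
  interpret pair_wf_digraph H by fact
  have "distinct p"
  proof (rule ccontr)
    assume "\<not> distinct p"
    then obtain xs ys zs y where eq: "p = xs @ [y] @ ys @ [y] @ zs"
      using not_distinct_decomp by blast
    have walk: "vwalk (xs @ [y] @ zs) (with_proj H)"
      using p(1) vwalkI_append_r[of "[y] @ zs" "xs @ [y] @ ys" "with_proj H"]
      unfolding eq by (cases "xs = []") (auto simp: vwalk_def vwalk_arcs_append)
    have "hd (xs @ [y] @ zs) = u" "last (xs @ [y] @ zs) = v"
      using p(2,3) by (auto simp: eq hd_append)
    with graph_dist_le_vwalk_length[OF wf walk]
    have "graph_dist H u v \<le> ereal (real (length xs + length zs))" by simp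
    then show False using len[symmetric] by (simp add: eq)
  qed
  with assms show ?thesis by (simp add: shortest_path_def vpath_def)
qed

section \<open>Deforming walks whose last vertex is free\<close>

text \<open>Only the first vertex is pinned. Vertices may repeat, since a sliding walk folds back on
  itself.\<close>

definition walk_move :: "'a pair_pre_digraph \<Rightarrow> 'a \<Rightarrow> nat \<Rightarrow> 'a vwalk \<Rightarrow> 'a vwalk \<Rightarrow> bool" where
  "walk_move H u d p q \<longleftrightarrow> vwalk p (with_proj H) \<and> vwalk q (with_proj H) \<and>
     length p = Suc d \<and> length q = Suc d \<and> hd p = u \<and> hd q = u \<and>
     (\<exists>m. \<forall>i < Suc d. i \<noteq> m \<longrightarrow> p ! i = q ! i)"

text \<open>
  Sweep \<open>s\<close> turns the heights \<open>\<bar>i - s\<bar> - s\<close> into \<open>\<bar>i - (s + 1)\<bar> - (s + 1)\<close> by lowering the positions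
  \<open>d, d - 1, \<dots>, s + 1\<close> by 2 in this order; after \<open>t\<close> of these steps the positions above \<open>d - t\<close> are
  done. Sweeps \<open>0, \<dots>, d - 1\<close> lead from height \<open>i\<close> to height \<open>-i\<close> at every position \<open>i\<close>.
\<close>

definition slide_height :: "nat \<Rightarrow> nat \<Rightarrow> nat \<Rightarrow> nat \<Rightarrow> int" where
  "slide_height d s t i =
     (if i + t \<le> d then \<bar>int i - int s\<bar> - int s else \<bar>int i - int s - 1\<bar> - int s - 1)"

lemma relpowp_walk_move:
  assumes "pair_sym_digraph H"
    and p: "vwalk p (with_proj H)" "length p = Suc d"
    and q: "vwalk q (with_proj H)" "length q = Suc d"
    and hd: "hd p = u" "hd q = u"
  shows "(walk_move H u d ^^ (Suc d choose 2)) p q"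
proof -
  interpret pair_sym_digraph H by fact
  have wf: "pair_wf_digraph H" ..
  \<comment> \<open>The track: the reverse of \<open>q\<close> followed by \<open>p\<close>, indexed
    by height so that \<open>u\<close> sits at 0, the end of \<open>p\<close> at \<open>d\<close>
    and the end of \<open>q\<close> at \<open>-d\<close>.\<close>
  define T where "T z = (if z \<ge> 0 then p ! nat z else q ! nat (- z))" for z :: int
  have p0: "p ! 0 = u" and q0: "q ! 0 = u"
    using hd p q by (metis hd_conv_nth length_0_conv nat.distinct(1))+
  have T_vert: "T z \<in> pverts H" if "\<bar>z\<bar> \<le> int d" for z
    using that p q unfolding T_def vwalk_iff_nth[OF wf] by (auto simp: subset_iff)
  have T_up: "(T z, T (z + 1)) \<in> parcs H" if "- int d \<le> z" "z < int d" for z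
  proof (cases "z \<ge> 0")
    case True
    have "(p ! nat z, p ! Suc (nat z)) \<in> parcs H"
      using True that p unfolding vwalk_iff_nth[OF wf] by auto
    with True show ?thesis by (simp add: T_def nat_add_distrib)
  next
    case False
    define n where "n = nat (- z - 1)"
    have n: "z = - int n - 1" "Suc n \<le> d" using False that by (auto simp: n_def)
    have "(q ! n, q ! Suc n) \<in> parcs H"
      using n q unfolding vwalk_iff_nth[OF wf] by auto
    then have "(q ! Suc n, q ! n) \<in> parcs H" by (rule arcs_symmetric)
    moreover have "T z = q ! Suc n" using n by (simp add: T_def nat_add_distrib)
    \<comment> \<open>For \<open>n = 0\<close> the height is 0, where \<open>T\<close> reads
      \<open>p\<close>; both walks have \<open>u\<close> there.\<close>
    moreover have "T (z + 1) = q ! n" using n p0 q0 by (simp add: T_def)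
    ultimately show ?thesis by simp
  qed
  have T_adj: "(T y, T z) \<in> parcs H" if "\<bar>y\<bar> \<le> int d" "\<bar>z\<bar> \<le> int d" "\<bar>y - z\<bar> = 1" for y z
  proof (cases "z = y + 1")
    case False
    then have "y = z + 1" using that by auto
    then show ?thesis using T_up[of z] that by (auto intro: arcs_symmetric)
  qed (use T_up[of y] that in auto)
  define slide where "slide s t = map (\<lambda>i. T (slide_height d s t i)) [0..<Suc d]" for s t
  \<comment> \<open>The two formulas meet between positions \<open>d - t\<close> and
    \<open>d - t + 1\<close>. As \<open>t \<le> d - s\<close>, this lies no further left than
    \<open>s\<close>, so the height drops there from \<open>d - t - 2 * s\<close> by exactly
    1.\<close>
  have slide_walk: "vwalk (slide s t) (with_proj H)" if "s < d" "t \<le> d - s" for s t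
  proof -
    have "\<bar>slide_height d s t i\<bar> \<le> int d" if "i \<le> d" for i
      using that \<open>s < d\<close> \<open>t \<le> d - s\<close> unfolding slide_height_def by auto
    moreover have "\<bar>slide_height d s t i - slide_height d s t (Suc i)\<bar> = 1" if "Suc i \<le> d" for i
      using that \<open>s < d\<close> \<open>t \<le> d - s\<close> unfolding slide_height_def by auto
    ultimately show ?thesis
      unfolding vwalk_iff_nth[OF wf] slide_def
      by (auto simp del: upt_Suc intro!: T_vert T_adj)
  qed
  have slide_hd: "hd (slide s t) = u" if "s < d" "t \<le> d - s" for s t
    using that p0 q0 by (auto simp: slide_def hd_map slide_height_def T_def simp del: upt_Suc)
  have move: "walk_move H u d (slide s t) (slide s (Suc t))" if "s < d" "t < d - s" for s t
    unfolding walk_move_def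
  proof (intro conjI)
    show "\<exists>m. \<forall>i < Suc d. i \<noteq> m \<longrightarrow> slide s t ! i = slide s (Suc t) ! i"
      using that by (intro exI[of _ "d - t"]) (auto simp: slide_def slide_height_def simp del: upt_Suc)
  qed (use that slide_walk[of s t] slide_walk[of s "Suc t"] slide_hd[of s t] slide_hd[of s "Suc t"]
      in \<open>auto simp: slide_def\<close>)
  \<comment> \<open>Positions \<open>i \<le> s\<close> are not touched by sweep \<open>s\<close>,
    but both formulas give the height \<open>-i\<close> there.\<close>
  have next_sweep: "slide s (d - s) = slide (Suc s) 0" if "s < d" for s
    unfolding slide_def using that by (auto simp: slide_height_def simp del: upt_Suc intro!: arg_cong[of _ _ T])
  have sweep: "(walk_move H u d ^^ (d - s)) (slide s 0) (slide (Suc s) 0)" if "s < d" for s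
    using relpowp_sum[where n = "d - s" and R = "walk_move H u d" and c = "\<lambda>_. 1" and w = "slide s"]
      move[OF that] next_sweep[OF that] by (simp add: eq_OO)
  have "(walk_move H u d ^^ (\<Sum>s<d. d - s)) (slide 0 0) (slide d 0)"
    by (rule relpowp_sum) (rule sweep)
  moreover have "(\<Sum>s<d. d - s) = (Suc d choose 2)"
    by (induction d) (auto simp: sum.lessThan_Suc_shift numeral_2_eq_2 simp del: sum.lessThan_Suc)
  moreover have "slide 0 0 = p"
    by (rule nth_equalityI) (use p in \<open>auto simp: slide_def slide_height_def T_def simp del: upt_Suc\<close>)
  moreover have "slide d 0 = q"
    by (rule nth_equalityI) (use q p0 q0 in \<open>auto simp: slide_def slide_height_def T_def simp del: upt_Suc\<close>)
  ultimately show ?thesis by simp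
qed

section \<open>Moving the coordinates from one shortest path to the other\<close>

theorem corollary5p2:
  fixes H :: "'a pair_pre_digraph" and u v :: 'a and k d :: nat
  assumes "k \<ge> 3"
    and "pair_pseudo_graph H"
    and "nu_graph k H"
    and "u \<in> pverts H" and "v \<in> pverts H"
    and "graph_dist H u v = ereal (real d)"
  shows "graph_diameter (sp_graph H u v) \<le> ereal (real ((k - 2) * ((d + 1) choose 2)))"
proof -
  interpret pair_pseudo_graph H by fact
  have wf: "pair_wf_digraph H" and sym: "pair_sym_digraph H" ..
  interpret S: pair_bidirected_digraph "sp_graph H u v" by (rule pair_bidirected_digraph_sp_graph)
  have S_wf: "pair_wf_digraph (sp_graph H u v)" ..
  obtain f where f: "graph_hom (graph_power H k) H f"
    and nu: "\<And>x a. x \<in> {1..k} \<rightarrow>\<^sub>E pverts H \<Longrightarrow> a \<in> pverts H \<Longrightarrow>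
      card {i \<in> {1..k}. x i = a} \<ge> k - 1 \<Longrightarrow> f x = a"
    using assms(3) by (auto simp: nu_graph_def graph_power_def)
  \<comment> \<open>Here \<open>j\<close> is the one coordinate free to disagree; it may lie outside
    \<open>{1..k}\<close>, so no bound on it has to be carried along.\<close>
  have nu': "f x = a" if "x \<in> {1..k} \<rightarrow>\<^sub>E pverts H" "a \<in> pverts H"
    "\<And>i. i \<in> {1..k} \<Longrightarrow> i \<noteq> j \<Longrightarrow> x i = a" for x a j
  proof (rule nu)
    have "k - 1 \<le> card ({1..k} - {j})" by (simp add: card_Diff_singleton_if)
    also have "\<dots> \<le> card {i \<in> {1..k}. x i = a}" by (rule card_mono) (use that in auto)
    finally show "k - 1 \<le> card {i \<in> {1..k}. x i = a}" .
  qed fact+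
  have dist: "graph_dist (sp_graph H u v) p q \<le> ereal (real ((k - 2) * ((d + 1) choose 2)))"
    if "p \<in> pverts (sp_graph H u v)" "q \<in> pverts (sp_graph H u v)" for p q
  proof -
    have sp: "shortest_path H u v p" "shortest_path H u v q"
      using that by (simp_all add: sp_graph_def)
    have walk: "vwalk r (with_proj H)" "length r = Suc d" "r ! 0 = u" "r ! d = v" "hd r = u"
      if "shortest_path H u v r" for r
    proof -
      show r: "vwalk r (with_proj H)" "hd r = u"
        using that by (auto simp: shortest_path_def)
      then have "r \<noteq> []" by auto
      then show len: "length r = Suc d"
        using that assms(6) by (cases r) (auto simp: shortest_path_def)
      show "r ! 0 = u" using r \<open>r \<noteq> []\<close> by (simp add: hd_conv_nth)
      show "r ! d = v" using that len \<open>r \<noteq> []\<close> by (simp add: shortest_path_def last_conv_nth)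
    qed
    note P = walk[OF sp(1)] and Q = walk[OF sp(2)]
    \<comment> \<open>\<open>j\<close> counts the coordinates already switched from \<open>p\<close>
      to \<open>q\<close>, and \<open>w\<close> is the walk being deformed in the next one.\<close>
    define tup where "tup j w i = (\<lambda>l\<in>{1..k}.
      if l \<le> j then q ! i else if l = Suc j then w ! i else p ! i)" for j i and w :: "'a vwalk"
    define mix where "mix j w = map (\<lambda>i. f (tup j w i)) [0..<length w]" for j w
    have vert: "r ! i \<in> pverts H" if "vwalk r (with_proj H)" "i < length r" for r i
      using that by (auto simp: vwalk_def)
    have edge: "(r ! i, r ! Suc i) \<in> parcs H" if "vwalk r (with_proj H)" "Suc i < length r" for r i
      using that by (simp add: vwalk_iff_nth[OF wf])
    have tup_vert: "tup j w i \<in> {1..k} \<rightarrow>\<^sub>E pverts H"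
      if "vwalk w (with_proj H)" "length w = Suc d" "i \<le> d" for j w i
      using that P Q vert by (auto simp: tup_def)
    have mix_sp: "shortest_path H u v (mix j w)"
      if w: "vwalk w (with_proj H)" "length w = Suc d" "hd w = u" for j w
    proof (rule shortest_pathI[OF wf])
      have "f (tup j w i) \<in> pverts H" if "i \<le> d" for i
        using f tup_vert[OF w(1,2) that, of j] by (auto simp: graph_hom_def graph_power_def)
      moreover have "(f (tup j w i), f (tup j w (Suc i))) \<in> parcs H" if "Suc i \<le> d" for i
      proof -
        have "(tup j w i, tup j w (Suc i)) \<in> parcs (graph_power H k)"
          using that tup_vert[OF w(1,2), of i j] tup_vert[OF w(1,2), of "Suc i" j] P Q w edge
          by (auto simp: graph_power_def tup_def)
        then show ?thesis using f by (auto simp: graph_hom_def)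
      qed
      ultimately show "vwalk (mix j w) (with_proj H)"
        unfolding vwalk_iff_nth[OF wf] mix_def using w by (auto simp del: upt_Suc)
      have "f (tup j w 0) = u"
        by (rule nu'[of _ _ "Suc j"]) (use tup_vert[OF w(1,2)] assms(4) P Q in \<open>auto simp: tup_def\<close>)
      then show "hd (mix j w) = u"
        using w by (simp add: mix_def hd_map del: upt_Suc)
      have "f (tup j w d) = v"
        by (rule nu'[of _ _ "Suc j"]) (use tup_vert[OF w(1,2)] assms(5) P Q in \<open>auto simp: tup_def\<close>)
      then show "last (mix j w) = v"
        using w by (simp add: mix_def)
      show "ereal (real (vwalk_length (mix j w))) = graph_dist H u v"
        using w assms(6) by (simp add: mix_def)
    qed
    define R where "R = (\<lambda>a b. a = b \<or> (a, b) \<in> parcs (sp_graph H u v))"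
    have mix_move: "R (mix j a) (mix j b)" if ab: "walk_move H u d a b" for j a b
    proof -
      let ?a = "mix j a" and ?b = "mix j b"
      have len: "length ?a = Suc d" "length ?b = Suc d"
        using ab by (auto simp: mix_def walk_move_def)
      obtain m where m: "\<And>i. i < Suc d \<Longrightarrow> i \<noteq> m \<Longrightarrow> a ! i = b ! i"
        using ab by (auto simp: walk_move_def)
      have same: "?a ! i = ?b ! i" if "i < Suc d" "i \<noteq> m" for i
      proof -
        have "tup j a i = tup j b i" by (simp only: tup_def m[OF that])
        with that ab show ?thesis by (auto simp: mix_def walk_move_def simp del: upt_Suc)
      qed
      have "shortest_path H u v ?a" "shortest_path H u v ?b"
        using ab by (simp_all add: mix_sp walk_move_def)
      \<comment> \<open>\<open>f\<close> acts on each position separately, so the two images can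
        differ at \<open>m\<close> only.\<close>
      moreover have "\<exists>!i. i < length ?a \<and> ?a ! i \<noteq> ?b ! i" if "?a \<noteq> ?b"
      proof -
        have "\<exists>i<Suc d. ?a ! i \<noteq> ?b ! i"
          using that len by (auto simp: list_eq_iff_nth_eq)
        then obtain i where "i < Suc d" "?a ! i \<noteq> ?b ! i" by blast
        with same len show ?thesis by (intro ex1I[of _ i]) auto
      qed
      ultimately show ?thesis by (auto simp: R_def sp_graph_def)
    qed
    have moves: "(walk_move H u d ^^ (Suc d choose 2)) p q"
      by (rule relpowp_walk_move[OF sym]) (use P Q in simp_all)
    have "(R ^^ (Suc d choose 2)) (mix j p) (mix j q)" for j
      using relpowp_image[OF moves, of R "mix j"] mix_move by blast
    \<comment> \<open>A completed deformation in coordinate \<open>j + 1\<close> gives the starting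
      tuple for coordinate \<open>j + 2\<close>.\<close>
    moreover have "mix j q = mix (Suc j) p" for j
      using P Q by (auto simp: mix_def tup_def intro!: arg_cong[of _ _ f])
    ultimately have "(R ^^ (Suc d choose 2)) (mix (Suc j) p) (mix (Suc (Suc j)) p)" for j by metis
    \<comment> \<open>Starting at index 1 means that coordinate 1 holds \<open>q\<close> from the
      outset; stopping at \<open>k - 1\<close> leaves \<open>p\<close> in coordinate
      \<open>k\<close>. This saves two of \<open>k\<close> rounds.\<close>
    then have "(R ^^ (\<Sum>j<k - 2. Suc d choose 2)) (mix (Suc 0) p) (mix (Suc (k - 2)) p)"
      by (intro relpowp_sum)
    moreover have "mix (Suc 0) p = p"
    proof (rule nth_equalityI)
      fix i assume "i < length (mix (Suc 0) p)"
      then have i: "i \<le> d" using P by (simp add: mix_def)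
      have "f (tup (Suc 0) p i) = p ! i"
        by (rule nu'[of _ _ 1]) (use tup_vert[OF P(1,2) i] vert P i in \<open>auto simp: tup_def\<close>)
      then show "mix (Suc 0) p ! i = p ! i"
        using i P by (simp add: mix_def del: upt_Suc)
    qed (simp add: mix_def)
    moreover have "mix (Suc (k - 2)) p = q"
    proof (rule nth_equalityI)
      fix i assume "i < length (mix (Suc (k - 2)) p)"
      then have i: "i \<le> d" using P by (simp add: mix_def)
      have "f (tup (Suc (k - 2)) p i) = q ! i"
        by (rule nu'[of _ _ k])
          (use assms(1) tup_vert[OF P(1,2) i] vert Q i in \<open>auto simp: tup_def\<close>)
      then show "mix (Suc (k - 2)) p ! i = q ! i"
        using i P by (simp add: mix_def del: upt_Suc)
    qed (use P Q in \<open>simp add: mix_def\<close>)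
    ultimately have "(R ^^ ((k - 2) * (Suc d choose 2))) p q" by simp
    then show ?thesis
      unfolding R_def Suc_eq_plus1 by (rule graph_dist_le_of_relpowp[OF S_wf that(1)])
  qed
  show ?thesis
    unfolding graph_diameter_def by (intro SUP_least dist)
qed

end
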